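(* Let $g=\sum_{n\ge 0}x^{n^{2}}\in\mathbb{Z}/2[[x]]$, write $\frac{1}{g}=\sum_{i\ge 0}b_{i}x^{i}$ with $b_{i}\in\mathbb{Z}/2$, and let $B=\{n\ge 0: b_{n}=1\}$. If $n\equiv 7\pmod{16}$, then $n\in B$ if and only if the number of ordered triples $(t_1,t_2,t_3)$ of squares of integers with $n=t_1+2t_2+4t_3$ is odd.
   Context: $\mathbb{Z}/2[[x]]$ is the ring of formal power series over the field with two elements; $g$ has constant term $1$ and so is invertible there. "Squares of integers" means elements of $\{0,1,4,9,\dots\}$; triples are counted as tuples of these square values. *)

theory Defs
  imports
    "HOL-Library.Z2"
    "HOL-Computational_Algebra.Formal_Power_Series"
    "HOL-Computational_Algebra.Nth_Powers"
    "HOL-Number_Theory.Cong"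
begin

text \<open>
  The infinite sum is taken in the \<open>X\<close>-adic topology on formal power series; the lemmas
  below show that it converges and what its coefficients are.
\<close>

definition g_series :: "bit fps" where
  "g_series = (\<Sum>n. fps_X ^ (n\<^sup>2))"

definition b_coeff :: "nat \<Rightarrow> bit" where
  "b_coeff i = fps_nth (inverse g_series) i"

definition B_set :: "nat set" where
  "B_set = {n. b_coeff n = 1}"

lemma g_sums_squares: "(\<lambda>n. fps_X ^ (n\<^sup>2)) sums Abs_fps (\<lambda>m. of_bool (is_square m) :: bit)"
  unfolding sums_def
proof (rule tendsto_fpsI)
  fix m :: nat
  have "fps_nth (\<Sum>i<N. fps_X ^ (i\<^sup>2)) m = (of_bool (is_square m) :: bit)" if "N > m" for N
  proof -
    have "fps_nth (\<Sum>i<N. fps_X ^ (i\<^sup>2)) m = (\<Sum>i<N. if m = i\<^sup>2 then 1 else 0 :: bit)"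
      by (simp add: fps_sum_nth fps_X_power_nth)
    also have "\<dots> = of_bool (is_square m)"
    proof (cases "is_square m")
      case True
      then obtain k where k: "m = k\<^sup>2" by (auto elim: is_nth_powerE)
      have "k \<le> m" unfolding k by (simp add: power2_eq_square)
      then have "k < N" using that by simp
      have "(\<Sum>i<N. if m = i\<^sup>2 then 1 else 0 :: bit) = (\<Sum>i<N. if k = i then 1 else 0)"
        by (intro sum.cong) (auto simp: k)
      then show ?thesis using \<open>k < N\<close> True by simp
    next
      case False
      then have "m \<noteq> i\<^sup>2" for i by (auto simp: is_nth_power_def)
      then show ?thesis using False by simp
    qed
    finally show ?thesis .
  qed
  then show "\<forall>\<^sub>F N in sequentially. fps_nth (\<Sum>i<N. fps_X ^ (i\<^sup>2)) m =
      fps_nth (Abs_fps (\<lambda>m. of_bool (is_square m) :: bit)) m"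
    unfolding eventually_sequentially by (intro exI[of _ "Suc m"]) auto
qed

lemma fps_nth_g: "fps_nth g_series m = of_bool (is_square m)"
  unfolding g_series_def using sums_unique[OF g_sums_squares] by (metis fps_nth_Abs_fps)

lemma inverse_g_mult_g: "inverse g_series * g_series = 1"
  by (rule inverse_mult_eq_1) (simp add: fps_nth_g)

end

theory Submission
  imports Defs
begin

text \<open>
  Over the field with two elements \<open>1/g = g\<^sup>7/g\<^sup>8\<close>, where \<open>g\<^sup>8 = g(x\<^sup>8)\<close> and
  \<open>g\<^sup>7 = g(x) g(x\<^sup>2) g(x\<^sup>4)\<close> counts the triples modulo 2. Let \<open>A\<close> be the sum of the \<open>x\<^sup>t\<close> over
  the odd squares \<open>t\<close>. In exponents congruent to 7 modulo 8, \<open>g\<^sup>7\<close> agrees with \<open>A\<^sup>7\<close>, and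
  \<open>A\<^sup>7(1/g\<^sup>8 - 1)\<close> equals \<open>A\<^sup>6/g(x)\<^bsup>16\<^esup>\<close>, which lives in exponents congruent to 6 modulo 16, times
  \<open>A (g(x\<^sup>8) - g(x\<^bsup>16\<^esup>))\<close>. So it suffices that for \<open>N\<close> congruent to 1 modulo 16 the equations
  \<open>y\<^sup>2 + 8 m\<^sup>2 = N\<close> and \<open>y\<^sup>2 + 16 m\<^sup>2 = N\<close> have equally many solutions \<open>y > 0, m \<ge> 0\<close>
  modulo 2.

  This is read off modulo 4 from the integral theta identity \<open>\<psi>(q) \<phi>(-q\<^sup>2) = \<psi>(-q) \<phi>(q)\<close>, with
  \<open>q = x\<^sup>8\<close>. Both sides have the same square, because \<open>\<psi>(q)\<^sup>2 = \<phi>(q) \<psi>(q\<^sup>2)\<close> and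
  \<open>\<phi>(q) \<phi>(-q) = \<phi>(-q\<^sup>2)\<^sup>2\<close>, and these two identities come from the substitution
  \<open>(u, v) = (j + k, j - k)\<close>.
\<close>

section \<open>Weighted theta series and their products\<close>

text \<open>The formal sum of the terms \<open>w k * x^(f k)\<close>. The index type is arbitrary so
  that a product can be indexed by pairs. A sum over an infinite level is 0 by convention, hence the
  companion condition \<open>finite_levels\<close>.\<close>

definition theta :: "('a \<Rightarrow> int) \<Rightarrow> ('a \<Rightarrow> 'b) \<Rightarrow> 'b::comm_ring_1 fps" where
  "theta f w = Abs_fps (\<lambda>n. \<Sum>k | f k = int n. w k)"

definition finite_levels :: "('a \<Rightarrow> int) \<Rightarrow> bool" where
  "finite_levels f \<longleftrightarrow> (\<forall>k. 0 \<le> f k) \<and> (\<forall>n. finite {k. f k = int n})"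

lemma theta_nth [simp]: "fps_nth (theta f w) n = (\<Sum>k | f k = int n. w k)"
  by (simp add: theta_def)

lemma Sigma_levels:
  assumes "\<And>a. 0 \<le> f a" "\<And>b. 0 \<le> g b"
  shows "{p. (case p of (a, b) \<Rightarrow> f a + g b) = int n} =
    (\<Union>i\<in>{0..n}. {a. f a = int i} \<times> {b. g b = int (n - i)})" (is "?L = ?R")
proof
  show "?L \<subseteq> ?R"
  proof
    fix p assume "p \<in> ?L"
    then obtain a b where p: "p = (a, b)" "f a + g b = int n" by (cases p) auto
    then show "p \<in> ?R"
      using assms(1)[of a] assms(2)[of b] by (intro UN_I[of "nat (f a)"]) auto
  qed
  show "?R \<subseteq> ?L" by auto
qed

lemma finite_levels_add:
  assumes "finite_levels f" "finite_levels g"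
  shows "finite_levels (\<lambda>(a, b). f a + g b)"
proof -
  have "finite {p. (case p of (a, b) \<Rightarrow> f a + g b) = int n}" for n
    using assms by (subst Sigma_levels) (auto simp: finite_levels_def simp del: of_nat_diff)
  then show ?thesis using assms by (auto simp: finite_levels_def)
qed

text \<open>A pair on level \<open>n\<close> lies in exactly one block \<open>f a = i\<close>,
  \<open>g b = n - i\<close>; summing block by block is the Cauchy product.\<close>

lemma theta_mult:
  assumes "finite_levels f" "finite_levels g"
  shows "theta f w * theta g v = theta (\<lambda>(a, b). f a + g b) (\<lambda>(a, b). w a * v b)"
proof (rule fps_ext)
  fix n
  have "fps_nth (theta (\<lambda>(a, b). f a + g b) (\<lambda>(a, b). w a * v b)) n =
    (\<Sum>i\<in>{0..n}. \<Sum>(a, b)\<in>{a. f a = int i} \<times> {b. g b = int (n - i)}. w a * v b)"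
    unfolding theta_nth using assms
    by (subst Sigma_levels, simp add: finite_levels_def, simp add: finite_levels_def,
        subst sum.UNION_disjoint) (auto simp: finite_levels_def simp del: of_nat_diff)
  also have "\<dots> = fps_nth (theta f w * theta g v) n"
    by (simp add: fps_mult_nth sum_product sum.cartesian_product)
  finally show "fps_nth (theta f w * theta g v) n =
    fps_nth (theta (\<lambda>(a, b). f a + g b) (\<lambda>(a, b). w a * v b)) n" ..
qed

lemma finite_levels_int:
  assumes "\<And>k::int. \<bar>k\<bar> \<le> f k"
  shows "finite_levels f"
proof -
  have "finite {k. f k = int n}" for n
  proof (rule finite_subset)
    show "{k. f k = int n} \<subseteq> {- int n..int n}"
    proof
      fix k assume "k \<in> {k. f k = int n}"
      with assms[of k] show "k \<in> {- int n..int n}" by auto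
    qed
  qed simp
  moreover have "0 \<le> f k" for k using assms[of k] by linarith
  ultimately show ?thesis by (auto simp: finite_levels_def)
qed

lemma abs_le_square: "\<bar>k\<bar> \<le> (k::int)\<^sup>2"
proof -
  have "\<bar>k\<bar> * 1 \<le> \<bar>k\<bar> * \<bar>k\<bar>" by (cases "k = 0") (simp, intro mult_left_mono, auto)
  then show ?thesis by (simp add: power2_eq_square)
qed

lemma finite_levels_square:
  assumes "1 \<le> c"
  shows "finite_levels (\<lambda>m::int. c * m\<^sup>2)"
proof (rule finite_levels_int)
  fix m :: int
  have "1 * m\<^sup>2 \<le> c * m\<^sup>2" using assms by (intro mult_right_mono) auto
  then show "\<bar>m\<bar> \<le> c * m\<^sup>2" using abs_le_square[of m] by linarith
qed

lemma finite_levels_odd_square: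
  assumes "1 \<le> c"
  shows "finite_levels (\<lambda>k::int. c * (4 * k + 1)\<^sup>2)"
proof (rule finite_levels_int)
  fix k :: int
  have "1 * (4 * k + 1)\<^sup>2 \<le> c * (4 * k + 1)\<^sup>2" using assms by (intro mult_right_mono) auto
  then show "\<bar>k\<bar> \<le> c * (4 * k + 1)\<^sup>2" using abs_le_square[of "4 * k + 1"] by linarith
qed

lemma finite_levels_nat_square:
  assumes "1 \<le> c"
  shows "finite_levels (\<lambda>m::nat. c * (int m)\<^sup>2)"
proof -
  have "finite {m::nat. c * (int m)\<^sup>2 = int n}" for n
  proof (rule finite_imageD)
    show "finite (int ` {m. c * (int m)\<^sup>2 = int n})"
      by (rule finite_subset[of _ "{m. c * m\<^sup>2 = int n}"])
        (use finite_levels_square[OF assms] in \<open>auto simp: finite_levels_def\<close>)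
  qed simp
  then show ?thesis using assms by (auto simp: finite_levels_def)
qed

section \<open>Theta identities with integer coefficients\<close>

text \<open>For \<open>e = 1\<close> or \<open>e = -1\<close> this is \<open>e^k\<close>; the parity
  form also covers negative \<open>k\<close>.\<close>

definition parity_sign :: "int \<Rightarrow> int \<Rightarrow> int" where
  "parity_sign e k = (if even k then 1 else e)"

text \<open>
  With \<open>q = x\<^sup>8\<close>, the sum of \<open>x\<^sup>t\<close> with \<open>t = (4k + 1)\<^sup>2\<close> over all integers \<open>k\<close> is \<open>x \<psi>(q)\<close>; twisting by
  \<open>e = -1\<close> replaces \<open>q\<close> by \<open>-q\<close>, since the exponent \<open>2k\<^sup>2 + k\<close> of \<open>q\<close> has the parity of \<open>k\<close>.
\<close>

lemma theta_odd_squares_square: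
  assumes "e * e = 1"
  shows "theta (\<lambda>k::int. (4 * k + 1)\<^sup>2) (parity_sign e) ^ 2 =
    theta (\<lambda>m. 8 * m\<^sup>2) (parity_sign e) * theta (\<lambda>k::int. 2 * (4 * k + 1)\<^sup>2) (\<lambda>_. 1)"
proof (rule fps_ext)
  fix n
  \<comment> \<open>Both maps rest on \<open>(4j+1)^2 + (4k+1)^2 = 8(j-k)^2 + 2(2s+1)^2\<close> with
    \<open>s = j + k\<close>. The number \<open>2s+1\<close> is \<open>4r+1\<close> for
    \<open>s = 2r\<close>, and its negative is \<open>4r+1\<close> for \<open>s = -1 - 2r\<close>.
    Since \<open>s\<close> has the parity of \<open>m = j - k\<close>, the case split can be
    undone.\<close>
  let ?i = "\<lambda>(m, k). let u = (if even m then 2 * k else - 1 - 2 * k) in ((u + m) div 2, (u - m) div 2)"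
  let ?j = "\<lambda>(j, k). (j - k, if even (j + k) then (j + k) div 2 else (- 1 - j - k) div 2)"
  have "(\<Sum>p | (case p of (j, k) \<Rightarrow> (4 * j + 1)\<^sup>2 + (4 * k + 1)\<^sup>2) = int n.
       case p of (j, k) \<Rightarrow> parity_sign e j * parity_sign e k) =
     (\<Sum>p | (case p of (m, k) \<Rightarrow> 8 * m\<^sup>2 + 2 * (4 * k + 1)\<^sup>2) = int n.
       case p of (m, k) \<Rightarrow> parity_sign e m * 1)"
  proof (rule sum.reindex_bij_witness[of _ ?i ?j])
    fix p assume "p \<in> {p. (case p of (j, k) \<Rightarrow> (4 * j + 1)\<^sup>2 + (4 * k + 1)\<^sup>2) = int n}"
    then obtain j k where p: "p = (j, k)" "(4 * j + 1)\<^sup>2 + (4 * k + 1)\<^sup>2 = int n" by (cases p) auto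
    show "?i (?j p) = p" using p(1) by (auto simp: Let_def)
    show "?j p \<in> {p. (case p of (m, k) \<Rightarrow> 8 * m\<^sup>2 + 2 * (4 * k + 1)\<^sup>2) = int n}"
    proof (cases "even (j + k)")
      case True
      then obtain r where r: "j = 2 * r - k" by (metis evenE add_diff_cancel_right')
      then have "?j p = (2 * r - 2 * k, r)" using p by simp
      then show ?thesis using p r by (simp add: power2_eq_square algebra_simps)
    next
      case False
      then obtain r where r: "j = 2 * r + 1 - k" by (metis oddE add_diff_cancel_right')
      then have "?j p = (2 * r + 1 - 2 * k, - 1 - r)" using p by simp
      then show ?thesis using p r by (simp add: power2_eq_square algebra_simps)
    qed
    \<comment> \<open>If \<open>j\<close> and \<open>k\<close> are both odd, their signs multiply to
      \<open>e * e = 1\<close>, the sign of the even number \<open>j - k\<close>.\<close>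
    show "(case ?j p of (m, k) \<Rightarrow> parity_sign e m * 1) = (case p of (j, k) \<Rightarrow> parity_sign e j * parity_sign e k)"
      using p assms by (auto simp: parity_sign_def)
  next
    fix p assume "p \<in> {p. (case p of (m, k) \<Rightarrow> 8 * m\<^sup>2 + 2 * (4 * k + 1)\<^sup>2) = int n}"
    then obtain m k where p: "p = (m, k)" "8 * m\<^sup>2 + 2 * (4 * k + 1)\<^sup>2 = int n" by (cases p) auto
    have "?j (?i p) = p \<and> ?i p \<in> {p. (case p of (j, k) \<Rightarrow> (4 * j + 1)\<^sup>2 + (4 * k + 1)\<^sup>2) = int n}"
    proof (cases "even m")
      case True
      then obtain r where "m = 2 * r" by (metis evenE)
      then show ?thesis using p by (simp add: power2_eq_square algebra_simps)
    next
      case False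
      then obtain r where r: "m = 2 * r + 1" by (metis oddE)
      then have "?i p = (r - k, - 1 - k - r)"
        using p by (auto simp: Let_def)
      moreover have odd: "odd (r - k + (- 1 - k - r))" by presburger
      have "?j (r - k, - 1 - k - r) = (m, k)" using r by (simp only: prod.case odd if_False) simp
      ultimately show ?thesis using p r by (simp add: power2_eq_square algebra_simps)
    qed
    then show "?j (?i p) = p" "?i p \<in> {p. (case p of (j, k) \<Rightarrow> (4 * j + 1)\<^sup>2 + (4 * k + 1)\<^sup>2) = int n}"
      by blast+
  qed
  then show "fps_nth (theta (\<lambda>k::int. (4 * k + 1)\<^sup>2) (parity_sign e) ^ 2) n =
    fps_nth (theta (\<lambda>m. 8 * m\<^sup>2) (parity_sign e) * theta (\<lambda>k::int. 2 * (4 * k + 1)\<^sup>2) (\<lambda>_. 1)) n"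
    using finite_levels_odd_square[of 1] finite_levels_odd_square[of 2] finite_levels_square[of 8]
    by (simp add: power2_eq_square[of "theta _ _"] theta_mult)
qed

text \<open>This is \<open>\<phi>(q) \<phi>(-q) = \<phi>(-q^2)^2\<close> with
  \<open>q = x^8\<close>: pairs of opposite parity cancel, and those of equal parity are
  \<open>(j + k, j - k)\<close>.\<close>

lemma theta_squares_mult_alternating:
  "theta (\<lambda>m. 8 * m\<^sup>2) (parity_sign 1) * theta (\<lambda>m. 8 * m\<^sup>2) (parity_sign (- 1)) =
    theta (\<lambda>m. 16 * m\<^sup>2) (parity_sign (- 1)) ^ 2"
proof (rule fps_ext)
  fix n
  let ?S = "{p::int \<times> int. (case p of (j, k) \<Rightarrow> 8 * j\<^sup>2 + 8 * k\<^sup>2) = int n}"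
  let ?E = "{p \<in> ?S. even (fst p + snd p)}" and ?O = "{p \<in> ?S. odd (fst p + snd p)}"
  let ?w = "\<lambda>(j, k). parity_sign 1 j * parity_sign (- 1) k"
  have fin: "finite ?S"
    using finite_levels_add[OF finite_levels_square[of 8] finite_levels_square[of 8]] by (simp add: finite_levels_def)
  \<comment> \<open>The weight is the sign of the second coordinate, so swapping coordinates of
    opposite parity negates it.\<close>
  have "sum ?w ?O = sum (\<lambda>p. - ?w p) ?O"
    by (rule sum.reindex_bij_witness[of _ prod.swap prod.swap]) (auto simp: parity_sign_def add.commute)
  then have O: "sum ?w ?O = 0" by (simp add: sum_negf)
  have "?S = ?E \<union> ?O" by auto
  then have "sum ?w ?S = sum ?w ?E + sum ?w ?O"
    using fin by (metis (no_types, lifting) sum.union_disjoint finite_Un disjoint_iff mem_Collect_eq)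
  also have "\<dots> = sum ?w ?E" using O by simp
  also have "\<dots> = (\<Sum>p | (case p of (j, k) \<Rightarrow> 16 * j\<^sup>2 + 16 * k\<^sup>2) = int n.
       case p of (j, k) \<Rightarrow> parity_sign (- 1) j * parity_sign (- 1) k)"
  proof (rule sum.reindex_bij_witness[of _ "\<lambda>(j, k). (j + k, j - k)" "\<lambda>(u, v). ((u + v) div 2, (u - v) div 2)"])
    fix p assume "p \<in> ?E"
    then obtain u v where p: "p = (u, v)" "8 * u\<^sup>2 + 8 * v\<^sup>2 = int n" "even (u + v)" by (cases p) auto
    then obtain r where r: "u = 2 * r - v" by (metis evenE add_diff_cancel_right')
    have d: "(2 * r - 2 * v) div 2 = r - v" by linarith
    show "(case case p of (u, v) \<Rightarrow> ((u + v) div 2, (u - v) div 2) of (j, k) \<Rightarrow> (j + k, j - k)) = p"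
      using p r d by simp
    show "(case p of (u, v) \<Rightarrow> ((u + v) div 2, (u - v) div 2)) \<in>
        {p. (case p of (j, k) \<Rightarrow> 16 * j\<^sup>2 + 16 * k\<^sup>2) = int n}"
      using p r d by (simp add: power2_eq_square algebra_simps)
    show "(case case p of (u, v) \<Rightarrow> ((u + v) div 2, (u - v) div 2) of (j, k) \<Rightarrow> parity_sign (- 1) j * parity_sign (- 1) k) = ?w p"
      using p r d by (auto simp: parity_sign_def)
  next
    fix p :: "int \<times> int"
    assume "p \<in> {p. (case p of (j, k) \<Rightarrow> 16 * j\<^sup>2 + 16 * k\<^sup>2) = int n}"
    moreover obtain j k where "p = (j, k)" by (cases p) auto
    ultimately show "(case case p of (j, k) \<Rightarrow> (j + k, j - k) of (u, v) \<Rightarrow> ((u + v) div 2, (u - v) div 2)) = p"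
      "(case p of (j, k) \<Rightarrow> (j + k, j - k)) \<in> ?E"
      by (auto simp: power2_eq_square algebra_simps)
  qed
  finally show "fps_nth (theta (\<lambda>m. 8 * m\<^sup>2) (parity_sign 1) * theta (\<lambda>m. 8 * m\<^sup>2) (parity_sign (- 1))) n =
    fps_nth (theta (\<lambda>m. 16 * m\<^sup>2) (parity_sign (- 1)) ^ 2) n"
    using finite_levels_square[of 8] finite_levels_square[of 16]
    by (simp add: power2_eq_square[of "theta _ _"] theta_mult)
qed

text \<open>Integer power series form an integral domain, so equality of the squares leaves only a
  sign, which the coefficient of \<open>x\<close> decides.\<close>

lemma theta_exchange:
  "theta (\<lambda>k::int. (4 * k + 1)\<^sup>2) (parity_sign 1) * theta (\<lambda>m. 16 * m\<^sup>2) (parity_sign (- 1)) =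
    theta (\<lambda>k::int. (4 * k + 1)\<^sup>2) (parity_sign (- 1)) * theta (\<lambda>m. 8 * m\<^sup>2) (parity_sign 1)"
  (is "?P * ?F2 = ?P' * ?F")
proof -
  let ?F' = "theta (\<lambda>m. 8 * m\<^sup>2) (parity_sign (- 1))" and ?Q = "theta (\<lambda>k::int. 2 * (4 * k + 1)\<^sup>2) (\<lambda>_. 1::int)"
  have "(?P * ?F2)\<^sup>2 = (?F * ?Q) * (?F * ?F')"
    by (simp only: power_mult_distrib theta_odd_squares_square theta_squares_mult_alternating mult_1)
  also have "\<dots> = (?F' * ?Q) * ?F\<^sup>2"
    by (simp add: power2_eq_square mult_ac)
  also have "\<dots> = (?P' * ?F)\<^sup>2"
    using theta_odd_squares_square[of "- 1"] by (simp add: power_mult_distrib)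
  finally have or: "?P * ?F2 = ?P' * ?F \<or> ?P * ?F2 = - (?P' * ?F)"
    by (simp add: power2_eq_iff)
  \<comment> \<open>In the series over \<open>(4k+1)^2\<close> the exponent 0 never occurs and the
    exponent 1 only for \<open>k = 0\<close>; so both products have coefficient 1 at
    \<open>x\<close>.\<close>
  have z: "{k::int. (4 * k + 1)\<^sup>2 = 0} = {}" "{k::int. (4 * k + 1)\<^sup>2 = 1} = {0}"
    by (auto simp: power2_eq_1_iff) presburger+
  have m: "{m::int. 16 * m\<^sup>2 = 1} = {}" "{m::int. 8 * m\<^sup>2 = 1} = {}"
    by (auto, presburger+)
  have P: "fps_nth (theta (\<lambda>k::int. (4 * k + 1)\<^sup>2) (parity_sign e)) 0 = 0"
    "fps_nth (theta (\<lambda>k::int. (4 * k + 1)\<^sup>2) (parity_sign e)) 1 = 1" for e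
    unfolding theta_nth of_nat_0 of_nat_1 z by (simp_all add: parity_sign_def)
  have F: "fps_nth ?F2 0 = 1" "fps_nth ?F 0 = 1"
    by (simp_all add: parity_sign_def)
  have "fps_nth (?P * ?F2) 1 = 1" "fps_nth (?P' * ?F) 1 = 1"
    using P F by (simp_all add: fps_mult_nth del: theta_nth)
  then have "?P * ?F2 \<noteq> - (?P' * ?F)" by (metis fps_neg_nth one_neq_neg_one)
  then show ?thesis using or by blast
qed

section \<open>From signed sums to parities of counts\<close>

text \<open>Solutions with \<open>m > 0\<close> and \<open>m < 0\<close> have equal signed sums,
  each congruent modulo 2 to its number of terms; doubling lifts this to modulo 4. Solutions with
  \<open>m = 0\<close> occur only once in the signed sum, so their number is added again. That
  correction does not depend on \<open>c\<close>.\<close>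

lemma twisted_count_cong:
  fixes c :: int
  assumes "1 \<le> c"
  shows "[(\<Sum>(k, m) | (4 * k + 1)\<^sup>2 + c * m\<^sup>2 = int n. parity_sign (- 1) m) + int (card {k::int. (4 * k + 1)\<^sup>2 = int n})
    = 2 * int (card {(k::int, m::nat). (4 * k + 1)\<^sup>2 + c * (int m)\<^sup>2 = int n})] (mod 4)"
proof -
  let ?S = "{(k, m). (4 * k + 1)\<^sup>2 + c * m\<^sup>2 = int n}"
  let ?Z = "{p \<in> ?S. snd p = 0}" and ?P = "{p \<in> ?S. 0 < snd p}" and ?M = "{p \<in> ?S. snd p < 0}"
  let ?w = "\<lambda>(k::int, m). parity_sign (- 1) m"
  let ?N = "{(k::int, m::nat). (4 * k + 1)\<^sup>2 + c * (int m)\<^sup>2 = int n}"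
  have fin: "finite ?S"
    using finite_levels_add[OF finite_levels_odd_square[of 1] finite_levels_square[OF assms]]
    by (simp add: finite_levels_def case_prod_unfold)
  have M: "sum ?w ?M = sum ?w ?P"
    by (rule sum.reindex_bij_witness[of _ "\<lambda>(k, m). (k, - m)" "\<lambda>(k, m). (k, - m)"])
      (auto simp: parity_sign_def)
  have "?Z = (\<lambda>k. (k, 0)) ` {k::int. (4 * k + 1)\<^sup>2 = int n}" (is "_ = ?f ` ?K")
    by (auto simp: image_iff)
  then have cZ: "card ?Z = card ?K"
    by (simp only:) (rule card_image, simp add: inj_on_def)
  have "sum ?w ?Z = (\<Sum>p\<in>?Z. 1)"
    by (rule sum.cong) (auto simp: parity_sign_def)
  then have Z: "sum ?w ?Z = int (card ?Z)" by simp
  have "S = {p \<in> S. snd p = 0} \<union> ({p \<in> S. 0 < snd p} \<union> {p \<in> S. snd p < 0})"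
    for S :: "(int \<times> int) set" by (auto simp: linorder_not_less)
  then have "sum ?w ?S = sum ?w (?Z \<union> (?P \<union> ?M))" by (rule arg_cong)
  also have "\<dots> = sum ?w ?Z + (sum ?w ?P + sum ?w ?M)"
    by (subst sum.union_disjoint, (use fin in auto)[3], subst sum.union_disjoint) (use fin in auto)
  finally have sum: "sum ?w ?S = int (card ?Z) + (sum ?w ?P + sum ?w ?P)"
    by (simp only: M Z)
  have "card ?N = card (?Z \<union> ?P)"
    by (rule bij_betw_same_card[of "\<lambda>(k, m). (k, int m)"],
        rule bij_betw_byWitness[where f' = "\<lambda>(k, m). (k, nat m)"]) auto
  also have "\<dots> = card ?Z + card ?P"
    by (rule card_Un_disjoint) (use fin in auto)
  finally have N: "int (card ?N) = int (card ?Z) + int (card ?P)" by (simp only: of_nat_add)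
  have "[sum ?w ?P = (\<Sum>p\<in>?P. 1)] (mod 2)"
    by (rule cong_sum) (auto simp: parity_sign_def cong_def)
  then have P: "[sum ?w ?P = int (card ?P)] (mod 2)" by (simp only: card_eq_sum of_nat_sum of_nat_1)
  have "[z + (x + x) + z = 2 * (z + y)] (mod 4)" if xy: "[x = y] (mod 2)" for x y z :: int
  proof -
    obtain t where "y = x + 2 * t" using xy unfolding cong_iff_lin by blast
    then have "2 * (z + y) = z + (x + x) + z + 4 * t" by simp
    then show ?thesis unfolding cong_iff_lin by blast
  qed
  from this[OF P, of "int (card ?Z)"] show ?thesis
    by (simp only: sum N cZ)
qed

text \<open>The signed sums for \<open>c = 8\<close> and \<open>c = 16\<close> agree by
  \<open>theta_exchange\<close>, and the correction terms of \<open>twisted_count_cong\<close>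
  cancel.\<close>

lemma card_exchange:
  assumes "[n = 1] (mod 16)"
  shows "even (card {(k::int, m::nat). (4 * k + 1)\<^sup>2 + 8 * (int m)\<^sup>2 = int n}) \<longleftrightarrow>
    even (card {(k::int, m::nat). (4 * k + 1)\<^sup>2 + 16 * (int m)\<^sup>2 = int n})" (is "even (card ?A) \<longleftrightarrow> even (card ?B)")
proof -
  \<comment> \<open>Dividing the equation by 8 shows that \<open>k + m^2\<close> is even. Hence the
    sign in \<open>k\<close> supplied by \<open>theta_exchange\<close> may be replaced by the sign
    in \<open>m\<close>.\<close>
  have par: "even k \<longleftrightarrow> even m" if "(4 * k + 1)\<^sup>2 + 8 * m\<^sup>2 = int n" for k m :: int
  proof -
    have "[int 1 = int n] (mod int 16)" unfolding cong_int_iff by (rule cong_sym[OF assms])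
    then obtain t where "int n = 1 + 16 * t" unfolding cong_iff_lin by auto
    with that have "k + m\<^sup>2 = 2 * (t - k\<^sup>2)" by (simp add: power2_eq_square algebra_simps)
    then have "even (k + m\<^sup>2)" by simp
    then show ?thesis by simp
  qed
  have "(\<Sum>(k, m) | (4 * k + 1)\<^sup>2 + 16 * m\<^sup>2 = int n. parity_sign (- 1) m) =
    fps_nth (theta (\<lambda>k::int. (4 * k + 1)\<^sup>2) (parity_sign 1) * theta (\<lambda>m. 16 * m\<^sup>2) (parity_sign (- 1))) n"
    using finite_levels_odd_square[of 1] finite_levels_square[of 16]
    by (simp add: theta_mult case_prod_unfold) (simp add: parity_sign_def)
  also have "\<dots> = (\<Sum>(k, m) | (4 * k + 1)\<^sup>2 + 8 * m\<^sup>2 = int n. parity_sign (- 1) k)"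
    unfolding theta_exchange using finite_levels_odd_square[of 1] finite_levels_square[of 8]
    by (simp add: theta_mult case_prod_unfold) (simp add: parity_sign_def)
  also have "\<dots> = (\<Sum>(k, m) | (4 * k + 1)\<^sup>2 + 8 * m\<^sup>2 = int n. parity_sign (- 1) m)"
    by (rule sum.cong) (auto simp: parity_sign_def dest: par)
  finally have eq: "(\<Sum>(k, m) | (4 * k + 1)\<^sup>2 + 16 * m\<^sup>2 = int n. parity_sign (- 1) m) =
    (\<Sum>(k, m) | (4 * k + 1)\<^sup>2 + 8 * m\<^sup>2 = int n. parity_sign (- 1) m)" .
  have "[2 * int (card ?A) = 2 * int (card ?B)] (mod 4)"
    by (rule cong_trans[OF cong_sym[OF twisted_count_cong[of 8]]],
      simp, unfold eq[symmetric], rule twisted_count_cong) simp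
  then obtain t where "2 * int (card ?B) = 2 * int (card ?A) + 4 * t" unfolding cong_iff_lin by blast
  then have "int (card ?B) = int (card ?A) + 2 * t" by simp
  then have "even (int (card ?B)) \<longleftrightarrow> even (int (card ?A))" by simp
  then show ?thesis by simp
qed

section \<open>Squaring over the field with two elements\<close>

lemma bit_of_nat: "(of_nat n :: bit) = of_bool (odd n)"
  by (induction n) auto

text \<open>In the convolution the terms at \<open>i\<close> and \<open>n - i\<close> are equal and
  cancel in characteristic 2; only the middle term survives, and it is its own square root.\<close>

lemma fps_square_nth_bit:
  fixes f :: "bit fps"
  shows "fps_nth (f\<^sup>2) n = (if even n then fps_nth f (n div 2) else 0)"
proof -
  let ?h = "\<lambda>i. fps_nth f i * fps_nth f (n - i)"
  let ?L = "{i. 2 * i < n}" and ?U = "{i. i \<le> n \<and> n < 2 * i}" and ?M = "{i. 2 * i = n}"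
  have fin: "finite ?L" "finite ?U" "finite ?M"
    by (rule finite_subset[of _ "{..n}"]; auto)+
  have "{0..n} = (?L \<union> ?U) \<union> ?M" by auto
  then have "fps_nth (f\<^sup>2) n = sum ?h ((?L \<union> ?U) \<union> ?M)"
    by (simp add: power2_eq_square fps_mult_nth)
  also have "\<dots> = (sum ?h ?L + sum ?h ?U) + sum ?h ?M"
    by (subst sum.union_disjoint, (use fin in auto)[3], subst sum.union_disjoint) (use fin in auto)
  also have "sum ?h ?U = sum ?h ?L"
    by (rule sum.reindex_bij_witness[of _ "\<lambda>i. n - i" "\<lambda>i. n - i"]) auto
  also have "sum ?h ?L + sum ?h ?L = 0"
    by (cases "sum ?h ?L") auto
  also have "0 + sum ?h ?M = (if even n then fps_nth f (n div 2) else 0)"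
  proof (cases "even n")
    case True
    then have "?M = {n div 2}" by auto
    moreover have "n - n div 2 = n div 2" using True by auto
    ultimately show ?thesis using True by (cases "fps_nth f (n div 2)") simp_all
  next
    case False
    then have "?M = {}" by auto
    then show ?thesis using False by simp
  qed
  finally show ?thesis .
qed

lemma theta_square_bit:
  "(theta f (\<lambda>_. 1 :: bit))\<^sup>2 = theta (\<lambda>k. 2 * f k) (\<lambda>_. 1)"
proof (rule fps_ext)
  fix n
  show "fps_nth ((theta f (\<lambda>_. 1 :: bit))\<^sup>2) n = fps_nth (theta (\<lambda>k. 2 * f k) (\<lambda>_. 1)) n"
  proof (cases "even n")
    case True
    then have "{k. 2 * f k = int n} = {k. f k = int (n div 2)}" by auto
    then show ?thesis using True by (simp add: fps_square_nth_bit)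
  next
    case False
    then have "{k. 2 * f k = int n} = {}" by (auto, presburger)
    then show ?thesis using False by (simp add: fps_square_nth_bit)
  qed
qed

section \<open>Splitting \<open>g\<close> into odd and even squares\<close>

text \<open>The series \<open>A\<close> of the overview. Letting \<open>4k + 1\<close> run over all
  integers \<open>k\<close> meets each odd square exactly once, and matches the indexing of the
  integral identities.\<close>

abbreviation odd_squares :: "bit fps" where
  "odd_squares \<equiv> theta (\<lambda>k::int. (4 * k + 1)\<^sup>2) (\<lambda>_. 1)"

lemma g_series_theta: "g_series = theta (\<lambda>m::nat. (int m)\<^sup>2) (\<lambda>_. 1)"
proof (rule fps_ext)
  fix n
  have "card {m::nat. (int m)\<^sup>2 = int n} = of_bool (is_square n)"
  proof (cases "is_square n")
    case True
    then obtain r where "n = r\<^sup>2" by (auto elim: is_nth_powerE)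
    then have "{m::nat. (int m)\<^sup>2 = int n} = {r}" by (auto simp flip: of_nat_power)
    then show ?thesis using True by simp
  next
    case False
    then have "{m::nat. (int m)\<^sup>2 = int n} = {}"
      by (auto simp: is_nth_power_def simp flip: of_nat_power)
    then show ?thesis using False by simp
  qed
  then show "fps_nth g_series n = fps_nth (theta (\<lambda>m::nat. (int m)\<^sup>2) (\<lambda>_. 1)) n"
    by (simp add: fps_nth_g)
qed

lemma g_series_powers:
  "g_series ^ 2 = theta (\<lambda>m::nat. 2 * (int m)\<^sup>2) (\<lambda>_. 1)"
  "g_series ^ 4 = theta (\<lambda>m::nat. 4 * (int m)\<^sup>2) (\<lambda>_. 1)"
  "g_series ^ 8 = theta (\<lambda>m::nat. 8 * (int m)\<^sup>2) (\<lambda>_. 1)"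
  "g_series ^ 16 = theta (\<lambda>m::nat. 16 * (int m)\<^sup>2) (\<lambda>_. 1)"
proof -
  show 2: "g_series ^ 2 = theta (\<lambda>m::nat. 2 * (int m)\<^sup>2) (\<lambda>_. 1)"
    by (simp add: g_series_theta theta_square_bit)
  have "g_series ^ 4 = (g_series ^ 2) ^ 2" by (simp flip: power_mult)
  then show 4: "g_series ^ 4 = theta (\<lambda>m::nat. 4 * (int m)\<^sup>2) (\<lambda>_. 1)"
    by (simp add: 2 theta_square_bit)
  have "g_series ^ 8 = (g_series ^ 4) ^ 2" by (simp flip: power_mult)
  then show 8: "g_series ^ 8 = theta (\<lambda>m::nat. 8 * (int m)\<^sup>2) (\<lambda>_. 1)"
    by (simp add: 4 theta_square_bit)
  have "g_series ^ 16 = (g_series ^ 8) ^ 2" by (simp flip: power_mult)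
  then show "g_series ^ 16 = theta (\<lambda>m::nat. 16 * (int m)\<^sup>2) (\<lambda>_. 1)"
    by (simp add: 8 theta_square_bit)
qed

text \<open>Even squares are the numbers \<open>4 s^2\<close>, so they contribute
  \<open>g(x^4)\<close>, which is \<open>g^4\<close> in characteristic 2.\<close>

lemma g_series_split: "g_series = odd_squares + g_series ^ 4"
proof (rule fps_ext)
  fix n
  have o: "card {k::int. (4 * k + 1)\<^sup>2 = int n} = of_bool (is_square n \<and> odd n)"
  proof (cases "is_square n \<and> odd n")
    case True
    then obtain r where r: "n = r\<^sup>2" by (auto elim: is_nth_powerE)
    with True have "odd (int r)" by simp
    then have "\<exists>k. 4 * k + 1 = int r \<or> 4 * k + 1 = - int r" by presburger
    then obtain k where "4 * k + 1 = int r \<or> 4 * k + 1 = - int r" by blast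
    then have k: "(4 * k + 1)\<^sup>2 = int n" using r by auto
    \<comment> \<open>The other square root \<open>-(4k + 1)\<close> is 3 modulo 4.\<close>
    have "k' = k" if "(4 * k' + 1)\<^sup>2 = int n" for k'
    proof -
      have "(4 * k' + 1)\<^sup>2 = (4 * k + 1)\<^sup>2" using k that by simp
      then have "4 * k' + 1 = 4 * k + 1 \<or> 4 * k' + 1 = - (4 * k + 1)" by (simp only: power2_eq_iff)
      then show ?thesis by presburger
    qed
    then have "{k::int. (4 * k + 1)\<^sup>2 = int n} = {k}" using k by blast
    then show ?thesis using True by simp
  next
    case False
    have "False" if "(4 * k + 1)\<^sup>2 = int n" for k
    proof -
      have "int n = int ((nat \<bar>4 * k + 1\<bar>)\<^sup>2)" using that by simp
      then have "n = (nat \<bar>4 * k + 1\<bar>)\<^sup>2" by (simp only: of_nat_eq_iff)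
      then have "is_square n" unfolding is_nth_power_def by blast
      moreover have "odd (int n)" unfolding that[symmetric] by simp
      ultimately show False using False by simp
    qed
    then have "{k::int. (4 * k + 1)\<^sup>2 = int n} = {}" by auto
    then show ?thesis using False by simp
  qed
  have e: "card {m::nat. 4 * (int m)\<^sup>2 = int n} = of_bool (is_square n \<and> even n)"
  proof (cases "is_square n \<and> even n")
    case True
    then obtain r where r: "n = r\<^sup>2" by (auto elim: is_nth_powerE)
    with True have "even r" by simp
    then obtain s where "r = 2 * s" by blast
    with r have "int n = 4 * (int s)\<^sup>2" by (simp add: power2_eq_square)
    then have "{m::nat. 4 * (int m)\<^sup>2 = int n} = {s}" by simp
    then show ?thesis using True by simp
  next
    case False
    have "False" if "4 * (int m)\<^sup>2 = int n" for m
    proof -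
      have "int n = int ((2 * m)\<^sup>2)" using that by (simp add: power2_eq_square)
      then have "n = (2 * m)\<^sup>2" by (simp only: of_nat_eq_iff)
      then have "is_square n" "even n" unfolding is_nth_power_def by (blast, simp)
      then show False using False by blast
    qed
    then have "{m::nat. 4 * (int m)\<^sup>2 = int n} = {}" by auto
    then show ?thesis using False by simp
  qed
  show "fps_nth g_series n = fps_nth (odd_squares + g_series ^ 4) n"
    by (cases "is_square n"; cases "even n") (simp_all add: g_series_powers fps_nth_g o e)
qed

section \<open>Supports in residue classes\<close>

definition supp_cong :: "'a::zero fps \<Rightarrow> nat \<Rightarrow> nat \<Rightarrow> bool" where
  "supp_cong f m r \<longleftrightarrow> (\<forall>n. fps_nth f n \<noteq> 0 \<longrightarrow> [n = r] (mod m))"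

lemma supp_cong_dvd: "supp_cong f m r \<Longrightarrow> d dvd m \<Longrightarrow> supp_cong f d r"
  by (auto simp: supp_cong_def intro: cong_dvd_modulus_nat)

lemma supp_cong_nth_eq_0: "supp_cong f m r \<Longrightarrow> \<not> [n = r] (mod m) \<Longrightarrow> fps_nth f n = 0"
  by (auto simp: supp_cong_def)

lemma supp_cong_mult:
  fixes f g :: "'a::semiring_0 fps"
  assumes "supp_cong f m r" "supp_cong g m s"
  shows "supp_cong (f * g) m (r + s)"
  unfolding supp_cong_def
proof (intro allI impI)
  fix n assume "fps_nth (f * g) n \<noteq> 0"
  then obtain i where i: "i \<in> {0..n}" "fps_nth f i * fps_nth g (n - i) \<noteq> 0"
    unfolding fps_mult_nth by (meson sum.not_neutral_contains_not_neutral)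
  then have "fps_nth f i \<noteq> 0" "fps_nth g (n - i) \<noteq> 0" by auto
  then have "[i + (n - i) = r + s] (mod m)"
    using assms by (intro cong_add) (auto simp: supp_cong_def)
  then show "[n = r + s] (mod m)" using i by simp
qed

text \<open>Squaring substitutes \<open>x^2\<close> for \<open>x\<close>, so the modulus doubles
  along with the residue; a plain product would only keep the modulus.\<close>

lemma supp_cong_square:
  fixes f :: "bit fps"
  assumes "supp_cong f m r"
  shows "supp_cong (f\<^sup>2) (2 * m) (2 * r)"
  unfolding supp_cong_def
proof (intro allI impI)
  fix n assume "fps_nth (f\<^sup>2) n \<noteq> 0"
  then have "even n" "fps_nth f (n div 2) \<noteq> 0" by (auto simp: fps_square_nth_bit split: if_splits)
  then obtain t where t: "n = 2 * t" "[t = r] (mod m)"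
    using assms by (auto simp: supp_cong_def)
  then show "[n = 2 * r] (mod (2 * m))" by (simp add: cong_def)
qed

lemma supp_cong_power:
  fixes f :: "bit fps"
  assumes "supp_cong f m r"
  shows "supp_cong (f ^ (2 ^ j)) (2 ^ j * m) (2 ^ j * r)"
proof (induction j)
  case (Suc j)
  have "f ^ 2 ^ Suc j = (f ^ 2 ^ j)\<^sup>2"
    unfolding power_Suc2 power_mult ..
  then show ?case using supp_cong_square[OF Suc] by (simp add: mult_ac)
qed (use assms in simp)

lemma supp_odd_squares: "supp_cong odd_squares 8 1"
  unfolding supp_cong_def
proof (intro allI impI)
  fix n assume "fps_nth odd_squares n \<noteq> 0"
  then obtain k :: int where "(4 * k + 1)\<^sup>2 = int n" by fastforce
  then have "int n = 1 + 8 * (2 * k\<^sup>2 + k)" by (simp add: power2_eq_square algebra_simps)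
  then have "[int 1 = int n] (mod int 8)" unfolding cong_iff_lin
    by (intro exI[of _ "2 * k\<^sup>2 + k"]) simp
  then show "[n = 1] (mod 8)" unfolding cong_int_iff by (rule cong_sym)
qed

section \<open>Coefficients of \<open>1/g\<close> at exponents 7 modulo 16\<close>

text \<open>The coefficient is the sum modulo 2 of the two counts compared in
  \<open>card_exchange\<close>.\<close>

lemma nth_odd_squares_g8_g16:
  assumes "[n = 1] (mod 16)"
  shows "fps_nth (odd_squares * (g_series ^ 8 + g_series ^ 16)) n = 0"
proof -
  have "fps_nth (odd_squares * (g_series ^ 8 + g_series ^ 16)) n =
    of_nat (card {(k::int, m::nat). (4 * k + 1)\<^sup>2 + 8 * (int m)\<^sup>2 = int n}) +
    of_nat (card {(k::int, m::nat). (4 * k + 1)\<^sup>2 + 16 * (int m)\<^sup>2 = int n})"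
    unfolding g_series_powers using finite_levels_odd_square[of 1] finite_levels_nat_square[of 8] finite_levels_nat_square[of 16]
    by (simp add: distrib_left theta_mult case_prod_unfold)
  then show ?thesis using card_exchange[OF assms] by (simp add: bit_of_nat)
qed

lemma nth_triple:
  "fps_nth (g_series * g_series ^ 2 * g_series ^ 4) n =
    of_nat (card {((a, b), c). (int a)\<^sup>2 + 2 * (int b)\<^sup>2 + 4 * (int c)\<^sup>2 = int n})"
proof -
  note h = finite_levels_nat_square[of 1, simplified] finite_levels_nat_square[of 2, simplified]
    finite_levels_nat_square[of 4, simplified]
  have "g_series * g_series ^ 2 * g_series ^ 4 = theta (\<lambda>(p, c). (case p of (a, b) \<Rightarrow> (int a)\<^sup>2 + 2 * (int b)\<^sup>2)
      + 4 * (int c)\<^sup>2) (\<lambda>_. 1)"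
    unfolding g_series_powers unfolding g_series_theta
    by (subst theta_mult[OF h(1,2)], subst theta_mult[OF finite_levels_add[OF h(1,2)] h(3)])
      (simp add: case_prod_unfold)
  then show ?thesis by (simp add: case_prod_unfold)
qed

lemma nth_inverse_g:
  assumes "[n = 7] (mod 16)"
  shows "fps_nth (inverse g_series) n = fps_nth (g_series * g_series ^ 2 * g_series ^ 4) n"
proof -
  define G where "G = g_series"
  define H where "H = inverse G"
  define A where "A = odd_squares"
  have HG: "H * G = 1" unfolding H_def G_def by (rule inverse_g_mult_g)
  have "b + b = 0" for b :: bit by (cases b) simp_all
  then have char2: "x + x = 0" for x :: "bit fps"
    by (intro fps_ext) (simp only: fps_add_nth fps_zero_nth)
  have G: "G = A + G ^ 4" unfolding G_def A_def by (rule g_series_split)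
  have sqadd: "(x + y)\<^sup>2 = x\<^sup>2 + y\<^sup>2" for x y :: "bit fps"
    using char2[of "x * y"] by (simp add: power2_eq_square algebra_simps) 
  have G2: "G ^ 2 = A ^ 2 + G ^ 8"
    using arg_cong[OF G, of "\<lambda>x. x ^ 2"] by (simp add: sqadd flip: power_mult)
  have G4: "G ^ 4 = A ^ 4 + G ^ 16"
    using arg_cong[OF G2, of "\<lambda>x. x ^ 2"] by (simp add: sqadd flip: power_mult)
  \<comment> \<open>Expanding \<open>G\<close>, \<open>G^2\<close> and \<open>G^4\<close> in turn
    leaves, besides \<open>A^7\<close>, three terms with exponents 3 modulo 8, 1 modulo 4 and 0
    modulo 2; none of these can be 7 modulo 8.\<close>
  define U where "U = A * A ^ 2 * G ^ 16 + A * G ^ 8 * G ^ 4 + G ^ 4 * G ^ 2 * G ^ 4"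
  have G7: "G * G ^ 2 * G ^ 4 = A * A ^ 2 * A ^ 4 + U"
  proof -
    have "G * G ^ 2 * G ^ 4 = A * G ^ 2 * G ^ 4 + G ^ 4 * G ^ 2 * G ^ 4"
      by (subst G) (simp add: algebra_simps)
    also have "A * G ^ 2 * G ^ 4 = A * A ^ 2 * G ^ 4 + A * G ^ 8 * G ^ 4"
      by (subst G2) (simp add: algebra_simps)
    also have "A * A ^ 2 * G ^ 4 = A * A ^ 2 * A ^ 4 + A * A ^ 2 * G ^ 16"
      by (subst G4) (simp add: algebra_simps)
    finally show ?thesis by (simp add: U_def add_ac)
  qed
  have H: "H = (G * G ^ 2 * G ^ 4) * H ^ 8"
  proof -
    have "(G * G ^ 2 * G ^ 4) * H ^ 8 = H * (H * G) ^ 7"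
      by (simp add: power_mult_distrib eval_nat_numeral mult_ac)
    then show ?thesis by (simp add: HG)
  qed
  \<comment> \<open>Since \<open>H G = 1\<close>, the product on the right is
    \<open>H^8 + 1\<close>, and the two ones cancel.\<close>
  have H8: "H ^ 8 = 1 + H ^ 16 * (G ^ 8 + G ^ 16)"
  proof -
    have "H ^ 16 = H ^ 8 * H ^ 8" by (simp flip: power_add)
    then have "H ^ 16 * (G ^ 8 + G ^ 16) = H ^ 8 * (H * G) ^ 8 + (H * G) ^ 16"
      by (simp only: power_mult_distrib distrib_left mult.assoc)
    then have "1 + H ^ 16 * (G ^ 8 + G ^ 16) = H ^ 8 + (1 + 1)"
      by (simp only: HG power_one mult_1_right add_ac)
    then show ?thesis by (simp only: char2 add_0_right)
  qed
  have A: "supp_cong A 8 1" unfolding A_def by (rule supp_odd_squares)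
  \<comment> \<open>Modulus 1 imposes nothing, but repeated squaring from it places
    \<open>f^(2^j)\<close> in exponents divisible by \<open>2^j\<close>.\<close>
  have any: "supp_cong f 1 0" for f :: "bit fps" by (simp add: supp_cong_def)
  have A2: "supp_cong (A ^ 2) 16 2" and A4: "supp_cong (A ^ 4) 32 4"
    using supp_cong_power[OF A, of 1] supp_cong_power[OF A, of 2] by simp_all
  have p: "supp_cong (f ^ 2) 2 0" "supp_cong (f ^ 4) 4 0" "supp_cong (f ^ 8) 8 0" "supp_cong (f ^ 16) 16 0"
    for f :: "bit fps"
    using supp_cong_power[OF any[of f], of 1] supp_cong_power[OF any[of f], of 2]
      supp_cong_power[OF any[of f], of 3] supp_cong_power[OF any[of f], of 4] by simp_all
  have n: "[n = 7] (mod 8)" using assms by (rule cong_dvd_modulus_nat) simp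
  \<comment> \<open>The factor \<open>f^8\<close> only shifts exponents by multiples of 8. Taking
    \<open>f = H\<close> removes \<open>U\<close> from \<open>1/g\<close>, and \<open>f = 1\<close>
    removes it from \<open>g^7\<close>.\<close>
  have U: "fps_nth (U * f ^ 8) n = 0" for f :: "bit fps"
  proof -
    have "supp_cong (A * A ^ 2 * G ^ 16 * f ^ 8) 8 (1 + 2 + 0 + 0)"
      by (intro supp_cong_mult A p supp_cong_dvd[OF A2] supp_cong_dvd[OF p(4)]) simp_all
    moreover have "supp_cong (A * G ^ 8 * G ^ 4 * f ^ 8) 4 (1 + 0 + 0 + 0)"
      by (intro supp_cong_mult p supp_cong_dvd[OF A] supp_cong_dvd[OF p(3)]) simp_all
    moreover have "supp_cong (G ^ 4 * G ^ 2 * G ^ 4 * f ^ 8) 2 (0 + 0 + 0 + 0)"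
      by (intro supp_cong_mult p supp_cong_dvd[OF p(2)] supp_cong_dvd[OF p(3)]) simp_all
    moreover have "\<not> [n = 1 + 2 + 0 + 0] (mod 8)" "\<not> [n = 1 + 0 + 0 + 0] (mod 4)" "\<not> [n = 0 + 0 + 0 + 0] (mod 2)"
      using n cong_dvd_modulus_nat[OF n, of 4] cong_dvd_modulus_nat[OF n, of 2]
      by (simp_all add: cong_def)
    ultimately have "fps_nth (A * A ^ 2 * G ^ 16 * f ^ 8) n = 0" "fps_nth (A * G ^ 8 * G ^ 4 * f ^ 8) n = 0"
      "fps_nth (G ^ 4 * G ^ 2 * G ^ 4 * f ^ 8) n = 0"
      by (blast intro: supp_cong_nth_eq_0)+
    then show ?thesis
      unfolding U_def distrib_right fps_add_nth by (simp only: add_0)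
  qed
  \<comment> \<open>The first factor lives in exponents 6 modulo 16, so the second is evaluated only
    at exponents 1 modulo 16, where it vanishes.\<close>
  have V: "fps_nth (A ^ 2 * A ^ 4 * H ^ 16 * (A * (G ^ 8 + G ^ 16))) n = 0"
    unfolding fps_mult_nth[of "A ^ 2 * A ^ 4 * H ^ 16"]
  proof (rule sum.neutral, rule ballI)
    fix i assume i: "i \<in> {0..n}"
    have s: "supp_cong (A ^ 2 * A ^ 4 * H ^ 16) 16 (2 + 4 + 0)"
      by (intro supp_cong_mult p A2 supp_cong_dvd[OF A4]) simp_all
    show "fps_nth (A ^ 2 * A ^ 4 * H ^ 16) i * fps_nth (A * (G ^ 8 + G ^ 16)) (n - i) = 0"
    proof (cases "[i = 6] (mod 16)")
      case True
      have "[i + (n - i) = 6 + 1] (mod 16)" using assms i by simp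
      then have "[6 + (n - i) = 6 + 1] (mod 16)"
        by (rule cong_trans[OF cong_add[OF cong_sym[OF True] cong_refl]])
      then have "[n - i = 1] (mod 16)" unfolding cong_add_lcancel_nat .
      then show ?thesis unfolding A_def G_def by (simp only: nth_odd_squares_g8_g16 mult_zero_right)
    next
      case False
      then have "fps_nth (A ^ 2 * A ^ 4 * H ^ 16) i = 0"
        using supp_cong_nth_eq_0[OF s] by simp
      then show ?thesis by (simp only: mult_zero_left)
    qed
  qed
  have "H = A * A ^ 2 * A ^ 4 * H ^ 8 + U * H ^ 8"
    by (subst H, subst G7) (rule distrib_right)
  also have "A * A ^ 2 * A ^ 4 * H ^ 8 = A * A ^ 2 * A ^ 4 + A ^ 2 * A ^ 4 * H ^ 16 * (A * (G ^ 8 + G ^ 16))"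
    by (subst H8) (simp add: algebra_simps)
  finally have "fps_nth H n = fps_nth (A * A ^ 2 * A ^ 4) n"
    using U[of H] V by (metis fps_add_nth add_0_right)
  also have "\<dots> = fps_nth (G * G ^ 2 * G ^ 4) n"
    unfolding G7 using U[of 1] by simp
  finally show ?thesis unfolding H_def G_def .
qed

theorem theorem3p6:
  fixes n :: nat
  assumes "[n = 7] (mod 16)"
  shows "n \<in> B_set \<longleftrightarrow>
    odd (card {(t1 :: int, t2 :: int, t3 :: int).
      is_square t1 \<and> is_square t2 \<and> is_square t3 \<and> int n = t1 + 2 * t2 + 4 * t3})"
proof -
  let ?K = "{((a, b), c). (int a)\<^sup>2 + 2 * (int b)\<^sup>2 + 4 * (int c)\<^sup>2 = int n}"
  let ?T = "{(t1 :: int, t2 :: int, t3 :: int).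
      is_square t1 \<and> is_square t2 \<and> is_square t3 \<and> int n = t1 + 2 * t2 + 4 * t3}"
  \<comment> \<open>Nonnegative roots make the passage from roots to squares injective; the nesting
    of pairs follows the iterated product in \<open>nth_triple\<close>.\<close>
  let ?f = "\<lambda>((a, b), c). ((int a)\<^sup>2, (int b)\<^sup>2, (int c)\<^sup>2)"
  have sq: "\<exists>a. t = (int a)\<^sup>2" if t: "is_square t" for t :: int
  proof -
    obtain y where "t = y\<^sup>2" using t by (rule is_nth_powerE)
    then show ?thesis by (intro exI[of _ "nat \<bar>y\<bar>"]) simp
  qed
  have "?T \<subseteq> ?f ` ?K"
  proof clarify
    fix t1 t2 t3 :: int
    assume "is_square t1" "is_square t2" "is_square t3" and eq: "int n = t1 + 2 * t2 + 4 * t3"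
    then obtain a b c where "t1 = (int a)\<^sup>2" "t2 = (int b)\<^sup>2" "t3 = (int c)\<^sup>2" using sq by meson
    then show "(t1, t2, t3) \<in> ?f ` ?K" using eq by (intro image_eqI[of _ _ "((a, b), c)"]) auto
  qed
  moreover have "?f ` ?K \<subseteq> ?T" by clarsimp
  ultimately have "?T = ?f ` ?K" by (rule subset_antisym)
  moreover have "inj_on ?f ?K" by (rule inj_onI) auto
  ultimately have "card ?T = card ?K" by (simp only: card_image)
  moreover have "n \<in> B_set \<longleftrightarrow> odd (card ?K)"
    using nth_inverse_g[OF assms] by (simp add: B_set_def b_coeff_def nth_triple bit_of_nat)
  ultimately show ?thesis by simp
qed

end
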